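(* Let $L_1$ and $L_2$ be finite dimensional Lie superalgebras and $L=L_1\oplus L_2$. Then: (1) $\operatorname{sol}(L)=\operatorname{sol}(L_1)\oplus\operatorname{sol}(L_2)$. (2) For any $x=(x_1,x_2)\in L$, $\operatorname{sol}_L(x)=\operatorname{sol}_{L_1}(x_1)\oplus\operatorname{sol}_{L_2}(x_2)$.
   Context: All Lie superalgebras are over a fixed field $\mathbb{F}$ with $\operatorname{char}\mathbb{F}\neq 2$ (if $\operatorname{char}\mathbb{F}=3$, the axioms also include $[x,[x,x]]=0$ for all odd $x$). "Subalgebra" means subsuperalgebra ($\mathbb{Z}_2$-graded subspace closed under the bracket), and $\langle x,y\rangle$ denotes the subalgebra (subsuperalgebra) generated by the (not necessarily homogeneous) elements $x,y$. Solvable means that the derived series reaches $0$. For a finite dimensional Lie superalgebra $K$ and $z\in K$: $\operatorname{sol}_K(z)=\{x\in K\mid\langle z,x\rangle\text{ is solvable}\}$, and $\operatorname{sol}(K)=\{x\in K\mid\langle z,x\rangle\text{ is solvable for all }z\in K\}$. These are in general only subsets. The direct sum $L_1\oplus L_2$ is the vector space direct sum with grading $(L_1\oplus L_2)_\alpha=(L_1)_\alpha\oplus(L_2)_\alpha$ and bracket $[x_1+y_1,x_2+y_2]=[x_1,x_2]_{L_1}+[y_1,y_2]_{L_2}$ for $x_i\in L_1$, $y_i\in L_2$. For subsets $S_i\subseteq L_i$, $S_1\oplus S_2$ denotes $\{(s_1,s_2)\mid s_1\in S_1,\ s_2\in S_2\}$. *)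

theory Defs
  imports "HOL-Analysis.Product_Vector" "HOL-Library.Z2"
begin

text \<open>The underlying vector space is the whole type \<open>'v\<close>, with scalar multiplication \<open>scl\<close>.
  The homogeneous components \<open>hom_part L a\<close> are indexed by \<open>bit\<close>, the field with two elements,
  so that addition of degrees is addition modulo two.\<close>

record ('k, 'v) superalgebra =
  scl :: "'k \<Rightarrow> 'v \<Rightarrow> 'v"
  hom_part :: "bit \<Rightarrow> 'v set"
  brk :: "'v \<Rightarrow> 'v \<Rightarrow> 'v"

text \<open>The sign \<open>(-1)\<^sup>a\<^sup>b\<close> for degrees \<open>a\<close> and \<open>b\<close>.\<close>

definition super_sign :: "bit \<Rightarrow> bit \<Rightarrow> 'k::field"
  where "super_sign a b = (if a * b = 1 then - 1 else 1)"

locale lie_superalgebra = vector_space "scl L"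
  for L :: "('k::field, 'v::ab_group_add) superalgebra" +
  assumes char_not_2: "CHAR('k) \<noteq> 2"
    and subspace_hom_part: "module.subspace (scl L) (hom_part L a)"
    and decomposition: "\<exists>!p. fst p \<in> hom_part L 0 \<and> snd p \<in> hom_part L 1 \<and> x = fst p + snd p"
    and brk_linear_left: "Vector_Spaces.linear (scl L) (scl L) (\<lambda>x. brk L x y)"
    and brk_linear_right: "Vector_Spaces.linear (scl L) (scl L) (\<lambda>y. brk L x y)"
    and brk_degree: "\<lbrakk>x \<in> hom_part L a; y \<in> hom_part L b\<rbrakk> \<Longrightarrow> brk L x y \<in> hom_part L (a + b)"
    and super_skew: "\<lbrakk>x \<in> hom_part L a; y \<in> hom_part L b\<rbrakk> \<Longrightarrow>
          brk L x y = - scl L (super_sign a b) (brk L y x)"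
    and super_jacobi: "\<lbrakk>x \<in> hom_part L a; y \<in> hom_part L b; z \<in> hom_part L c\<rbrakk> \<Longrightarrow>
          brk L x (brk L y z) = brk L (brk L x y) z + scl L (super_sign a b) (brk L y (brk L x z))"
    and odd_cube: "\<lbrakk>CHAR('k) = 3; x \<in> hom_part L 1\<rbrakk> \<Longrightarrow> brk L x (brk L x x) = 0"

locale fin_dim_lie_superalgebra = lie_superalgebra +
  assumes fin_dim: "\<exists>B. finite_dimensional_vector_space (scl L) B"

definition subsuperalgebra ::
    "('k::field, 'v::ab_group_add) superalgebra \<Rightarrow> 'v set \<Rightarrow> bool"
  where "subsuperalgebra L K \<longleftrightarrow>
    module.subspace (scl L) K \<and>
    (\<forall>x\<in>K. \<exists>x0\<in>K \<inter> hom_part L 0. \<exists>x1\<in>K \<inter> hom_part L 1. x = x0 + x1) \<and>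
    (\<forall>x\<in>K. \<forall>y\<in>K. brk L x y \<in> K)"

definition generated ::
    "('k::field, 'v::ab_group_add) superalgebra \<Rightarrow> 'v set \<Rightarrow> 'v set"
  where "generated L S = subsuperalgebra L hull S"

primrec derived_series ::
    "('k::field, 'v::ab_group_add) superalgebra \<Rightarrow> 'v set \<Rightarrow> nat \<Rightarrow> 'v set"
  where
    "derived_series L K 0 = K"
  | "derived_series L K (Suc n) =
      module.span (scl L)
        {brk L x y |x y. x \<in> derived_series L K n \<and> y \<in> derived_series L K n}"

definition solvable ::
    "('k::field, 'v::ab_group_add) superalgebra \<Rightarrow> 'v set \<Rightarrow> bool"
  where "solvable L K \<longleftrightarrow> (\<exists>n. derived_series L K n = {0})"

definition sol_at ::
    "('k::field, 'v::ab_group_add) superalgebra \<Rightarrow> 'v \<Rightarrow> 'v set"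
  where "sol_at L z = {x. solvable L (generated L {z, x})}"

definition sol ::
    "('k::field, 'v::ab_group_add) superalgebra \<Rightarrow> 'v set"
  where "sol L = {x. \<forall>z. solvable L (generated L {z, x})}"

definition direct_sum ::
    "('k::field, 'v::ab_group_add) superalgebra \<Rightarrow> ('k, 'w::ab_group_add) superalgebra
      \<Rightarrow> ('k, 'v \<times> 'w) superalgebra"  (infixr "\<oplus>\<^sub>s" 65)
  where "L1 \<oplus>\<^sub>s L2 =
    \<lparr>scl = module_prod.scale (scl L1) (scl L2),
     hom_part = (\<lambda>a. hom_part L1 a \<times> hom_part L2 a),
     brk = (\<lambda>(x1, y1) (x2, y2). (brk L1 x1 x2, brk L2 y1 y2))\<rparr>"

lemma fin_dim_lie_superalgebra_direct_sum:
  assumes "fin_dim_lie_superalgebra L1" "fin_dim_lie_superalgebra L2"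
  shows "fin_dim_lie_superalgebra (L1 \<oplus>\<^sub>s L2)"
proof -
  interpret A: fin_dim_lie_superalgebra L1 by fact
  interpret B: fin_dim_lie_superalgebra L2 by fact
  interpret P: vector_space_prod "scl L1" "scl L2" ..
  obtain B1 where B1: "finite_dimensional_vector_space (scl L1) B1" using A.fin_dim by blast
  obtain B2 where B2: "finite_dimensional_vector_space (scl L2) B2" using B.fin_dim by blast
  interpret F1: finite_dimensional_vector_space "scl L1" B1 by (rule B1)
  interpret F2: finite_dimensional_vector_space "scl L2" B2 by (rule B2)
  interpret F: finite_dimensional_vector_space_prod "scl L1" "scl L2" B1 B2 ..
  have lin: "Vector_Spaces.linear P.scale P.scale (\<lambda>p. (f (fst p), g (snd p)))"
    if "Vector_Spaces.linear (scl L1) (scl L1) f" "Vector_Spaces.linear (scl L2) (scl L2) g" for f g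
  proof -
    interpret f: Vector_Spaces.linear "scl L1" "scl L1" f by fact
    interpret g: Vector_Spaces.linear "scl L2" "scl L2" g by fact
    show ?thesis
      by unfold_locales (simp_all add: P.scale_def f.add g.add f.scale g.scale)
  qed
  have [simp]: "scl (L1 \<oplus>\<^sub>s L2) = P.scale"
    "hom_part (L1 \<oplus>\<^sub>s L2) a = hom_part L1 a \<times> hom_part L2 a"
    "brk (L1 \<oplus>\<^sub>s L2) p q = (brk L1 (fst p) (fst q), brk L2 (snd p) (snd q))" for a p q
    by (simp_all add: direct_sum_def split_beta)
  show ?thesis
  proof (intro fin_dim_lie_superalgebra.intro lie_superalgebra.intro lie_superalgebra_axioms.intro
      fin_dim_lie_superalgebra_axioms.intro)
    show "vector_space (scl (L1 \<oplus>\<^sub>s L2))"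
      using P.p.vector_space_axioms by simp
    show "CHAR('a) \<noteq> 2" by (rule A.char_not_2)
    show "module.subspace (scl (L1 \<oplus>\<^sub>s L2)) (hom_part (L1 \<oplus>\<^sub>s L2) a)" for a
      by (simp add: P.subspace_Times A.subspace_hom_part B.subspace_hom_part)
    show "\<exists>!p. fst p \<in> hom_part (L1 \<oplus>\<^sub>s L2) 0 \<and> snd p \<in> hom_part (L1 \<oplus>\<^sub>s L2) 1 \<and>
        x = fst p + snd p" for x
    proof -
      obtain p where p: "fst p \<in> hom_part L1 0" "snd p \<in> hom_part L1 1" "fst x = fst p + snd p"
        and up: "\<And>p'. fst p' \<in> hom_part L1 0 \<and> snd p' \<in> hom_part L1 1 \<and> fst x = fst p' + snd p'
          \<Longrightarrow> p' = p"
        using A.decomposition[of "fst x"] by blast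
      obtain q where q: "fst q \<in> hom_part L2 0" "snd q \<in> hom_part L2 1" "snd x = fst q + snd q"
        and uq: "\<And>q'. fst q' \<in> hom_part L2 0 \<and> snd q' \<in> hom_part L2 1 \<and> snd x = fst q' + snd q'
          \<Longrightarrow> q' = q"
        using B.decomposition[of "snd x"] by blast
      show ?thesis
      proof (rule ex1I[of _ "((fst p, fst q), (snd p, snd q))"])
        fix r
        assume r: "fst r \<in> hom_part (L1 \<oplus>\<^sub>s L2) 0 \<and> snd r \<in> hom_part (L1 \<oplus>\<^sub>s L2) 1 \<and>
          x = fst r + snd r"
        have "(fst (fst r), fst (snd r)) = p" "(snd (fst r), snd (snd r)) = q"
          using r by (auto intro!: up uq)
        then show "r = ((fst p, fst q), (snd p, snd q))"
          by (auto simp: prod_eq_iff)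
      qed (use p q in \<open>auto simp: prod_eq_iff\<close>)
    qed
    show "Vector_Spaces.linear (scl (L1 \<oplus>\<^sub>s L2)) (scl (L1 \<oplus>\<^sub>s L2)) (\<lambda>x. brk (L1 \<oplus>\<^sub>s L2) x y)" for y
      using lin[OF A.brk_linear_left B.brk_linear_left] by simp
    show "Vector_Spaces.linear (scl (L1 \<oplus>\<^sub>s L2)) (scl (L1 \<oplus>\<^sub>s L2)) (\<lambda>y. brk (L1 \<oplus>\<^sub>s L2) x y)" for x
      using lin[OF A.brk_linear_right B.brk_linear_right] by simp
    show "\<exists>B. finite_dimensional_vector_space (scl (L1 \<oplus>\<^sub>s L2)) B"
      using F.p.finite_dimensional_vector_space_axioms by auto
  next
    fix x y :: "'b \<times> 'c" and a b
    assume "x \<in> hom_part (L1 \<oplus>\<^sub>s L2) a" "y \<in> hom_part (L1 \<oplus>\<^sub>s L2) b"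
    then show "brk (L1 \<oplus>\<^sub>s L2) x y = - scl (L1 \<oplus>\<^sub>s L2) (super_sign a b) (brk (L1 \<oplus>\<^sub>s L2) y x)"
      by (auto simp: P.scale_def intro: A.super_skew B.super_skew)
  next
    fix x y :: "'b \<times> 'c" and a b
    assume "x \<in> hom_part (L1 \<oplus>\<^sub>s L2) a" "y \<in> hom_part (L1 \<oplus>\<^sub>s L2) b"
    then show "brk (L1 \<oplus>\<^sub>s L2) x y \<in> hom_part (L1 \<oplus>\<^sub>s L2) (a + b)"
      using A.brk_degree[of "fst x" a "fst y" b] B.brk_degree[of "snd x" a "snd y" b]
      by (simp add: mem_Times_iff)
  qed (auto simp: P.scale_def zero_prod_def intro: A.odd_cube B.odd_cube
        A.super_jacobi B.super_jacobi)
qed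

end

theory Submission
  imports Defs
begin

text \<open>
  Both parts reduce to one equivalence: the subsuperalgebra generated by two elements
  \<open>(z1, z2)\<close> and \<open>(x1, x2)\<close> of \<open>L1 \<oplus>\<^sub>s L2\<close> is solvable if and only if the ones generated by
  \<open>z1, x1\<close> in \<open>L1\<close> and by \<open>z2, x2\<close> in \<open>L2\<close> are.

  In general the subsuperalgebra \<open>K\<close> generated by the two pairs is a proper subset of the product
  of the two component subsuperalgebras, so it cannot be computed factor by factor. It does project
  \<^emph>\<open>onto\<close> each of them, because the coordinate projections are homomorphisms of
  superalgebras, and homomorphisms commute with generation (\<open>image_generated\<close>) and with the derived
  series (\<open>image_derived_series\<close>). Hence solvability of \<open>K\<close> passes to its two projections.
  Conversely, if both projections are solvable, a late term of the derived series of \<open>K\<close>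
  is killed by both projections; as the kernels meet only in \<open>0\<close>, that term is \<open>0\<close>
  (\<open>solvable_if_solvable_images\<close>).
\<close>

section \<open>Subsuperalgebras and derived series\<close>

context lie_superalgebra
begin

lemma homogeneous_components_unique:
  assumes "x0 \<in> hom_part L 0" "x1 \<in> hom_part L 1" "y0 \<in> hom_part L 0" "y1 \<in> hom_part L 1"
    and "x0 + x1 = y0 + y1"
  shows "x0 = y0" "x1 = y1"
proof -
  have "(x0, x1) = (y0, y1)"
    using decomposition[of "x0 + x1"] assms by (metis fst_conv snd_conv)
  then show "x0 = y0" "x1 = y1" by simp_all
qed

text \<open>Uniqueness of homogeneous components is what makes the grading condition survive
  intersections: the components of \<open>x\<close> found in the various members are the same vectors.\<close>

lemma subsuperalgebra_Inter:
  assumes sub: "\<And>K. K \<in> \<K> \<Longrightarrow> subsuperalgebra L K"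
  shows "subsuperalgebra L (\<Inter> \<K>)"
  unfolding subsuperalgebra_def
proof (intro conjI ballI)
  show "subspace (\<Inter> \<K>)"
    using sub by (intro subspace_Inter) (auto simp: subsuperalgebra_def)
next
  fix x assume x: "x \<in> \<Inter> \<K>"
  obtain x0 x1 where x01: "x0 \<in> hom_part L 0" "x1 \<in> hom_part L 1" "x = x0 + x1"
    using decomposition[of x] by blast
  have "x0 \<in> K \<and> x1 \<in> K" if K: "K \<in> \<K>" for K
  proof -
    have "x \<in> K" using x K by blast
    then obtain y0 y1 where "y0 \<in> K \<inter> hom_part L 0" "y1 \<in> K \<inter> hom_part L 1" "x = y0 + y1"
      using sub[OF K] unfolding subsuperalgebra_def by blast
    then show ?thesis
      using homogeneous_components_unique[of x0 x1 y0 y1] x01 by auto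
  qed
  then show "\<exists>x0\<in>\<Inter> \<K> \<inter> hom_part L 0. \<exists>x1\<in>\<Inter> \<K> \<inter> hom_part L 1. x = x0 + x1"
    using x01 by blast
next
  fix x y assume "x \<in> \<Inter> \<K>" "y \<in> \<Inter> \<K>"
  then show "brk L x y \<in> \<Inter> \<K>"
    using sub unfolding subsuperalgebra_def by blast
qed

lemma subsuperalgebra_generated: "subsuperalgebra L (generated L S)"
  unfolding generated_def hull_def by (rule subsuperalgebra_Inter) simp

lemma brk_zero_left: "brk L 0 y = 0"
proof -
  interpret l: Vector_Spaces.linear "scl L" "scl L" "\<lambda>x. brk L x y" by (rule brk_linear_left)
  show ?thesis by (rule l.zero)
qed

lemma derived_series_stays_zero:
  assumes "derived_series L K m = {0}" and "m \<le> n"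
  shows "derived_series L K n = {0}"
  using assms(2)
proof (induction n rule: dec_induct)
  case base
  show ?case by (rule assms(1))
next
  case (step n)
  then have "{brk L x y |x y. x \<in> derived_series L K n \<and> y \<in> derived_series L K n} = {0}"
    by (simp add: brk_zero_left)
  then show ?case by simp
qed

end

section \<open>Homomorphisms of Lie superalgebras\<close>

locale lie_superalgebra_hom =
  A: lie_superalgebra L + B: lie_superalgebra M + Vector_Spaces.linear "scl L" "scl M" f
  for L :: "('k::field, 'v::ab_group_add) superalgebra"
    and M :: "('k, 'w::ab_group_add) superalgebra"
    and f :: "'v \<Rightarrow> 'w" +
  assumes hom_part_image: "x \<in> hom_part L a \<Longrightarrow> f x \<in> hom_part M a"
    and brk_hom: "f (brk L x y) = brk M (f x) (f y)"
begin

lemma subsuperalgebra_image: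
  assumes "subsuperalgebra L K"
  shows "subsuperalgebra M (f ` K)"
  unfolding subsuperalgebra_def
proof (intro conjI ballI)
  show "B.subspace (f ` K)"
    using assms by (intro subspace_image) (simp add: subsuperalgebra_def)
next
  fix y assume "y \<in> f ` K"
  then obtain x where "x \<in> K" "y = f x" by blast
  then obtain x0 x1 where "x0 \<in> K \<inter> hom_part L 0" "x1 \<in> K \<inter> hom_part L 1" "y = f x0 + f x1"
    using assms add unfolding subsuperalgebra_def by metis
  then show "\<exists>y0\<in>f ` K \<inter> hom_part M 0. \<exists>y1\<in>f ` K \<inter> hom_part M 1. y = y0 + y1"
    using hom_part_image by blast
next
  fix y y' assume "y \<in> f ` K" "y' \<in> f ` K"
  then show "brk M y y' \<in> f ` K"
    using assms unfolding subsuperalgebra_def by (auto simp flip: brk_hom)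
qed

lemma subsuperalgebra_vimage:
  assumes "subsuperalgebra M K"
  shows "subsuperalgebra L (f -` K)"
  unfolding subsuperalgebra_def
proof (intro conjI ballI)
  show "A.subspace (f -` K)"
    using assms by (intro subspace_vimage) (simp add: subsuperalgebra_def)
next
  fix x assume "x \<in> f -` K"
  then obtain y0 y1 where y: "y0 \<in> K \<inter> hom_part M 0" "y1 \<in> K \<inter> hom_part M 1" "f x = y0 + y1"
    using assms unfolding subsuperalgebra_def by blast
  obtain x0 x1 where x: "x0 \<in> hom_part L 0" "x1 \<in> hom_part L 1" "x = x0 + x1"
    using A.decomposition[of x] by blast
  \<comment> \<open>\<open>f\<close> maps the components of \<open>x\<close> to components of \<open>f x\<close>, and these lie in \<open>K\<close> by uniqueness.\<close>
  have "f x0 = y0" "f x1 = y1"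
    using B.homogeneous_components_unique[of "f x0" "f x1" y0 y1] x y hom_part_image add by auto
  then show "\<exists>x0\<in>f -` K \<inter> hom_part L 0. \<exists>x1\<in>f -` K \<inter> hom_part L 1. x = x0 + x1"
    using x y by blast
next
  fix x x' assume "x \<in> f -` K" "x' \<in> f -` K"
  then show "brk L x x' \<in> f -` K"
    using assms unfolding subsuperalgebra_def by (auto simp: brk_hom)
qed

text \<open>Each inclusion is the minimality of one generated subsuperalgebra: the preimage of
  \<open>generated M (f ` S)\<close> is a subsuperalgebra containing \<open>S\<close>, and the image of \<open>generated L S\<close>
  is one containing \<open>f ` S\<close>.\<close>

lemma image_generated: "f ` generated L S = generated M (f ` S)"
proof
  have "generated L S \<subseteq> f -` generated M (f ` S)"
    unfolding generated_def[of L]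
  proof (rule hull_minimal)
    show "S \<subseteq> f -` generated M (f ` S)"
      using hull_subset[of "f ` S" "subsuperalgebra M"] unfolding generated_def by blast
    show "subsuperalgebra L (f -` generated M (f ` S))"
      by (intro subsuperalgebra_vimage B.subsuperalgebra_generated)
  qed
  then show "f ` generated L S \<subseteq> generated M (f ` S)" by blast
next
  show "generated M (f ` S) \<subseteq> f ` generated L S"
    unfolding generated_def[of M]
  proof (rule hull_minimal)
    show "f ` S \<subseteq> f ` generated L S"
      unfolding generated_def by (intro image_mono hull_subset)
    show "subsuperalgebra M (f ` generated L S)"
      by (intro subsuperalgebra_image A.subsuperalgebra_generated)
  qed
qed

lemma image_derived_series: "f ` derived_series L K n = derived_series M (f ` K) n"
proof (induction n)
  case 0
  show ?case by simp
next
  case (Suc n)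
  have "f ` {brk L x y |x y. x \<in> derived_series L K n \<and> y \<in> derived_series L K n} =
      {brk M x y |x y. x \<in> f ` derived_series L K n \<and> y \<in> f ` derived_series L K n}"
  proof (intro equalityI subsetI)
    fix z assume "z \<in> f ` {brk L x y |x y. x \<in> derived_series L K n \<and> y \<in> derived_series L K n}"
    then obtain x y where "z = f (brk L x y)" "x \<in> derived_series L K n" "y \<in> derived_series L K n"
      by blast
    then show "z \<in> {brk M x y |x y. x \<in> f ` derived_series L K n \<and> y \<in> f ` derived_series L K n}"
      unfolding brk_hom by blast
  next
    fix z assume "z \<in> {brk M x y |x y. x \<in> f ` derived_series L K n \<and> y \<in> f ` derived_series L K n}"
    then obtain x y where "z = brk M (f x) (f y)" "x \<in> derived_series L K n" "y \<in> derived_series L K n"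
      by blast
    then show "z \<in> f ` {brk L x y |x y. x \<in> derived_series L K n \<and> y \<in> derived_series L K n}"
      unfolding brk_hom[symmetric] by blast
  qed
  then show ?case
    by (simp add: Suc.IH flip: span_image)
qed

lemma solvable_image: "solvable L K \<Longrightarrow> solvable M (f ` K)"
  unfolding solvable_def by (metis image_derived_series image_empty image_insert zero)

end

text \<open>Past the larger of the derived lengths of the two images, the derived series of \<open>K\<close> lies in
  both kernels, which meet only in \<open>0\<close>. Going one term further puts \<open>0\<close> into it, since
  that term is a span.\<close>

lemma solvable_if_solvable_images:
  assumes "lie_superalgebra_hom L M f" and "lie_superalgebra_hom L N g"
    and inj: "\<And>x. f x = 0 \<Longrightarrow> g x = 0 \<Longrightarrow> x = 0"
    and "solvable M (f ` K)" and "solvable N (g ` K)"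
  shows "solvable L K"
proof -
  interpret f: lie_superalgebra_hom L M f by fact
  interpret g: lie_superalgebra_hom L N g by fact
  obtain m n where mn: "derived_series M (f ` K) m = {0}" "derived_series N (g ` K) n = {0}"
    using assms(4,5) unfolding solvable_def by blast
  let ?l = "Suc (max m n)"
  have "f ` derived_series L K ?l = {0}"
    unfolding f.image_derived_series
    by (rule f.B.derived_series_stays_zero[OF mn(1)]) simp
  moreover have "g ` derived_series L K ?l = {0}"
    unfolding g.image_derived_series
    by (rule g.B.derived_series_stays_zero[OF mn(2)]) simp
  ultimately have "derived_series L K ?l \<subseteq> {0}"
    using inj by blast
  moreover have "0 \<in> derived_series L K ?l"
    by (simp add: f.A.span_zero)
  ultimately have "derived_series L K ?l = {0}" by blast
  then show ?thesis unfolding solvable_def by blast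
qed

section \<open>Direct sums\<close>

lemma lie_superalgebra_hom_fst_snd:
  assumes "fin_dim_lie_superalgebra L1" and "fin_dim_lie_superalgebra L2"
  shows "lie_superalgebra_hom (L1 \<oplus>\<^sub>s L2) L1 fst"
    and "lie_superalgebra_hom (L1 \<oplus>\<^sub>s L2) L2 snd"
proof -
  interpret A: fin_dim_lie_superalgebra L1 by fact
  interpret B: fin_dim_lie_superalgebra L2 by fact
  interpret S: fin_dim_lie_superalgebra "L1 \<oplus>\<^sub>s L2"
    by (rule fin_dim_lie_superalgebra_direct_sum[OF assms])
  interpret P: vector_space_prod "scl L1" "scl L2" ..
  show "lie_superalgebra_hom (L1 \<oplus>\<^sub>s L2) L1 fst" "lie_superalgebra_hom (L1 \<oplus>\<^sub>s L2) L2 snd"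
    by unfold_locales (auto simp: direct_sum_def P.scale_def split_beta)
qed

lemma solvable_generated_direct_sum_iff:
  assumes "fin_dim_lie_superalgebra L1" and "fin_dim_lie_superalgebra L2"
  shows "solvable (L1 \<oplus>\<^sub>s L2) (generated (L1 \<oplus>\<^sub>s L2) S) \<longleftrightarrow>
    solvable L1 (generated L1 (fst ` S)) \<and> solvable L2 (generated L2 (snd ` S))"
proof -
  let ?K = "generated (L1 \<oplus>\<^sub>s L2) S"
  note homs = lie_superalgebra_hom_fst_snd[OF assms]
  interpret p: lie_superalgebra_hom "L1 \<oplus>\<^sub>s L2" L1 fst by (rule homs)
  interpret q: lie_superalgebra_hom "L1 \<oplus>\<^sub>s L2" L2 snd by (rule homs)
  have "solvable (L1 \<oplus>\<^sub>s L2) ?K \<longleftrightarrow> solvable L1 (fst ` ?K) \<and> solvable L2 (snd ` ?K)"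
    using p.solvable_image q.solvable_image solvable_if_solvable_images[OF homs]
    by (metis prod_eq_iff fst_zero snd_zero)
  then show ?thesis
    by (simp add: p.image_generated q.image_generated)
qed

theorem theorem5:
  fixes L1 :: "('k::field, 'v::ab_group_add) superalgebra"
    and L2 :: "('k, 'w::ab_group_add) superalgebra"
  assumes "fin_dim_lie_superalgebra L1" and "fin_dim_lie_superalgebra L2"
  shows "sol (L1 \<oplus>\<^sub>s L2) = sol L1 \<times> sol L2 \<and>
    (\<forall>x1 x2. sol_at (L1 \<oplus>\<^sub>s L2) (x1, x2) = sol_at L1 x1 \<times> sol_at L2 x2)"
proof -
  have "solvable (L1 \<oplus>\<^sub>s L2) (generated (L1 \<oplus>\<^sub>s L2) {(z1, z2), (x1, x2)}) \<longleftrightarrow>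
      solvable L1 (generated L1 {z1, x1}) \<and> solvable L2 (generated L2 {z2, x2})" for z1 z2 x1 x2
    using solvable_generated_direct_sum_iff[OF assms, of "{(z1, z2), (x1, x2)}"] by simp
  then show ?thesis
    by (auto simp: sol_def sol_at_def)
qed

end
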